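(* For every constant $\beta>0$ there is a constant $C>0$ such that for all sufficiently large $n$, with $N=2^n$, the number of independent sets $I$ of the hypercube graph $Q_n$ with $\min\{|I\cap\mathcal{E}|,|I\cap\mathcal{O}|\}>\beta N$ is at most $2^{N/2-\sqrt{N}/2^{C\sqrt{n}}}$.
   Context: $Q_n$ is the graph on vertex set $\mathbb{F}_2^n$ in which two vectors are adjacent iff they differ in exactly one coordinate. $\mathcal{E}$ (resp. $\mathcal{O}$) is the set of vectors of even (resp. odd) Hamming weight. (The paper writes the bound as $2^{N/2-\sqrt N/2^{\Theta(\sqrt n)}}$.) *)

theory Defs
  imports
    Complex_Main
    "HOL-Library.Z2"
    "Jordan_Normal_Form.Matrix"
    "Graph_Theory.Pair_Digraph"
begin

definition hamming_weight :: "bit vec \<Rightarrow> nat" where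
  "hamming_weight v = card {i. i < dim_vec v \<and> v $ i \<noteq> 0}"

text \<open>
  As usual in the graph theory library, an undirected graph is a symmetric digraph: every edge
  is represented by its two orientations.
\<close>

definition hypercube :: "nat \<Rightarrow> bit vec pair_pre_digraph" where
  "hypercube n = \<lparr> pverts = carrier_vec n,
     parcs = {(u, v). u \<in> carrier_vec n \<and> v \<in> carrier_vec n \<and> card {i. i < n \<and> u $ i \<noteq> v $ i} = 1} \<rparr>"

definition even_vectors :: "nat \<Rightarrow> bit vec set" where
  "even_vectors n = {v \<in> carrier_vec n. even (hamming_weight v)}"

definition odd_vectors :: "nat \<Rightarrow> bit vec set" where
  "odd_vectors n = {v \<in> carrier_vec n. odd (hamming_weight v)}"

definition independent_set :: "'a pair_pre_digraph \<Rightarrow> 'a set \<Rightarrow> bool" where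
  "independent_set G I \<longleftrightarrow> I \<subseteq> pverts G \<and> (\<forall>u\<in>I. \<forall>v\<in>I. (u, v) \<notin> parcs G)"

lemma bij_betw_vec_Pow:
  "bij_betw (\<lambda>v. {i. i < n \<and> v $ i \<noteq> 0}) (carrier_vec n :: bit vec set) (Pow {..<n})"
proof (rule bij_betwI[where g = "\<lambda>S. vec n (\<lambda>i. if i \<in> S then 1 else 0)"])
  show "vec n (\<lambda>i. if i \<in> {i. i < n \<and> x $ i \<noteq> 0} then 1 else 0) = x"
    if "x \<in> carrier_vec n" for x :: "bit vec"
    using that by (intro eq_vecI) (auto simp: bit_not_zero_iff)
qed (auto split: if_splits)

lemma finite_carrier_vec_bit: "finite (carrier_vec n :: bit vec set)"
  using bij_betw_finite[OF bij_betw_vec_Pow] by simp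

lemma card_carrier_vec_bit: "card (carrier_vec n :: bit vec set) = 2 ^ n"
  using bij_betw_same_card[OF bij_betw_vec_Pow] by (simp add: card_Pow)

lemma pair_graph_hypercube: "pair_graph (hypercube n)"
proof
  show "finite (parcs (hypercube n))"
    by (rule finite_subset[of _ "carrier_vec n \<times> carrier_vec n"])
      (auto simp: hypercube_def finite_carrier_vec_bit)
  have "{i. i < n \<and> u $ i \<noteq> v $ i} = {i. i < n \<and> v $ i \<noteq> u $ i}" for u v :: "bit vec"
    by auto
  then show "symmetric (with_proj (hypercube n))"
    by (auto simp: hypercube_def symmetric_def sym_def arcs_ends_conv image_def)
qed (auto simp: hypercube_def finite_carrier_vec_bit)

end

theory Submission
  imports Defs "HOL-Real_Asymp.Real_Asymp"
begin

text \<open>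
  Write \<open>I = A \<union> B\<close> with \<open>A\<close> even and \<open>B\<close> odd. A greedy choice of at most \<open>O(N/n)\<close> vertices of
  \<open>A\<close> and of \<open>B\<close> determines containers \<open>S \<supseteq> A\<close> and \<open>R \<supseteq> B\<close> between which all degrees are at most
  \<open>n/10\<close>; there are only \<open>exp (O(N log n / n))\<close> pairs \<open>(S, R)\<close>. For one such pair take a maximal
  matching between \<open>S\<close> and \<open>R\<close>, with \<open>M\<close> edges. Each matching edge costs a factor \<open>3/4\<close>, which
  outweighs the excess of \<open>|S| + |R|\<close> over \<open>N/2\<close>, at most \<open>M/5\<close> by the degree condition. If \<open>M\<close> is
  small, then deleting the matched vertices leaves sets without edges between them, whose total
  size is at most \<open>N/2 - c N / sqrt n\<close> by vertex isoperimetry. Either way a factor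
  \<open>2 powr (- c' N / sqrt n)\<close> is gained, far more than the number of containers costs.
\<close>

section \<open>Containers in regular bipartite graphs\<close>

definition cross_free :: "('a \<Rightarrow> 'b \<Rightarrow> bool) \<Rightarrow> 'a set \<Rightarrow> 'b set \<Rightarrow> bool" where
  "cross_free adj A B \<longleftrightarrow> (\<forall>u\<in>A. \<forall>v\<in>B. \<not> adj u v)"

section \<open>Tools: greedy covers, matchings, small subsets\<close>

text \<open>Take \<open>T\<close> maximal among the subsets of \<open>A\<close> whose sets
  \<open>f t\<close> together cover at least \<open>card T * k\<close> points. A \<open>u\<close>
  contributing \<open>k\<close> or more new points could be added to \<open>T\<close>. Later
  \<open>f\<close> gives neighbourhoods and \<open>T\<close> serves as a small fingerprint of
  \<open>A\<close>.\<close>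

lemma greedy_cover:
  fixes f :: "'a \<Rightarrow> 'b set"
  assumes "finite A" "finite W" "\<And>u. u \<in> A \<Longrightarrow> f u \<subseteq> W" "0 < k"
  obtains T where "T \<subseteq> A" "card T * k \<le> card W" "\<And>u. u \<in> A \<Longrightarrow> card (f u - (\<Union>t\<in>T. f t)) < k"
proof -
  define F where "F = {T. T \<subseteq> A \<and> card T * k \<le> card (\<Union>t\<in>T. f t)}"
  have "finite F" "{} \<in> F"
    using assms(1) by (auto simp: F_def intro: finite_subset[of _ "Pow A"])
  then obtain T where T: "T \<in> F" and max: "\<And>T'. T' \<in> F \<Longrightarrow> T \<subseteq> T' \<Longrightarrow> T = T'"
    using finite_has_maximal[of F] by auto
  have sub: "T \<subseteq> A" and le: "card T * k \<le> card (\<Union>t\<in>T. f t)"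
    using T by (auto simp: F_def)
  have fin: "finite T" "finite (\<Union>t\<in>T. f t)"
    using sub assms(1-3) by (auto intro: finite_subset)
  show thesis
  proof
    have "card (\<Union>t\<in>T. f t) \<le> card W"
      using sub assms by (intro card_mono) auto
    with le show "card T * k \<le> card W" by simp
    show "card (f u - (\<Union>t\<in>T. f t)) < k" if u: "u \<in> A" for u
    proof (rule ccontr)
      assume "\<not> ?thesis"
      then have big: "k \<le> card (f u - (\<Union>t\<in>T. f t))" by simp
      have "u \<notin> T"
      proof
        assume "u \<in> T"
        then have "f u - (\<Union>t\<in>T. f t) = {}" by auto
        with big \<open>0 < k\<close> show False by simp
      qed
      have "finite (f u)"
        using assms u finite_subset by blast
      then have "card (\<Union>t\<in>insert u T. f t) = card (f u - (\<Union>t\<in>T. f t)) + card (\<Union>t\<in>T. f t)"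
        using fin by (subst card_Un_disjoint[symmetric]) (auto intro: arg_cong[where f = card])
      then have "insert u T \<in> F"
        using big le sub u fin \<open>u \<notin> T\<close> by (auto simp: F_def)
      with max[of "insert u T"] \<open>u \<notin> T\<close> show False by auto
    qed
  qed (fact sub)
qed

text \<open>
  Deleting an edge together with its end points divides the number of independent sets by at
  most 3, whereas it divides the number of all subsets by 4.
\<close>

lemma matching_bound:
  fixes adj :: "'a \<Rightarrow> 'b \<Rightarrow> bool"
  assumes "finite S" "finite R"
  shows "\<exists>M P Q. P \<subseteq> S \<and> Q \<subseteq> R \<and> card P = M \<and> card Q = M \<and> cross_free adj (S - P) (R - Q) \<and>
    card {(A, B). A \<subseteq> S \<and> B \<subseteq> R \<and> cross_free adj A B} * 4 ^ M \<le> 3 ^ M * 2 ^ (card S + card R)"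
  using assms
proof (induction "card S" arbitrary: S R rule: less_induct)
  case less
  let ?F = "\<lambda>S R. {(A, B). A \<subseteq> S \<and> B \<subseteq> R \<and> cross_free adj A B}"
  have finF: "finite (?F S R)" if "finite S" "finite R" for S R
    by (rule finite_subset[of _ "Pow S \<times> Pow R"]) (use that in auto)
  show ?case
  proof (cases "cross_free adj S R")
    case True
    have "card (?F S R) \<le> card (Pow S \<times> Pow R)"
      using less.prems by (intro card_mono) auto
    then have "card (?F S R) \<le> 2 ^ (card S + card R)"
      using less.prems by (simp add: card_cartesian_product card_Pow power_add)
    with True show ?thesis
      by (intro exI[of _ 0] exI[of _ "{}"]) simp
  next
    case False
    then obtain u v where uv: "u \<in> S" "v \<in> R" "adj u v"
      by (auto simp: cross_free_def)
    define S' where "S' = S - {u}"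
    define R' where "R' = R - {v}"
    have fin: "finite S'" "finite R'" and cards: "card S = Suc (card S')" "card R = Suc (card R')"
      using less.prems uv card_Suc_Diff1[of S u] card_Suc_Diff1[of R v] by (auto simp: S'_def R'_def)
    obtain M P Q where IH: "P \<subseteq> S'" "Q \<subseteq> R'" "card P = M" "card Q = M"
      "cross_free adj (S' - P) (R' - Q)" "card (?F S' R') * 4 ^ M \<le> 3 ^ M * 2 ^ (card S' + card R')"
      using less.hyps[of S' R'] fin cards by auto
    \<comment> \<open>A pair is recorded by its restriction to \<open>S'\<close>, \<open>R'\<close>
      and its trace on the edge \<open>(u, v)\<close>; the trace \<open>(True, True)\<close> is
      excluded because \<open>adj u v\<close>, which leaves three of four.\<close>
    let ?g = "\<lambda>(A, B). ((A - {u}, B - {v}), (u \<in> A, v \<in> B))"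
    have "inj_on ?g (?F S R)"
      by (rule inj_onI) (auto 0 3)
    moreover have "?g ` ?F S R \<subseteq> ?F S' R' \<times> {(False, False), (True, False), (False, True)}"
      using uv by (auto simp: S'_def R'_def cross_free_def)
    moreover have "finite (?F S' R' \<times> {(False, False), (True, False), (False, True)})"
      using finF[OF fin] by blast
    ultimately have "card (?F S R) \<le> card (?F S' R' \<times> {(False, False), (True, False), (False, True)})"
      by (rule card_inj_on_le)
    then have "card (?F S R) \<le> 3 * card (?F S' R')"
      by (simp add: card_cartesian_product)
    then have "card (?F S R) * 4 ^ Suc M \<le> 3 * card (?F S' R') * 4 ^ Suc M"
      by (rule mult_right_mono) simp
    also have "\<dots> = 12 * (card (?F S' R') * 4 ^ M)" by simp
    also have "\<dots> \<le> 12 * (3 ^ M * 2 ^ (card S' + card R'))"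
      using IH(6) by simp
    also have "\<dots> = 3 ^ Suc M * 2 ^ (card S + card R)"
      by (simp add: cards)
    finally have "card (?F S R) * 4 ^ Suc M \<le> 3 ^ Suc M * 2 ^ (card S + card R)" .
    moreover have "S - insert u P = S' - P" "R - insert v Q = R' - Q"
      by (auto simp: S'_def R'_def)
    moreover have "u \<notin> P" "v \<notin> Q" "insert u P \<subseteq> S" "insert v Q \<subseteq> R"
      using IH(1,2) uv by (auto simp: S'_def R'_def)
    moreover have "finite P" "finite Q"
      using IH(1,2) fin by (auto intro: finite_subset)
    ultimately show ?thesis
      using IH(3-5)
      by (intro exI[of _ "Suc M"] exI[of _ "insert u P"] exI[of _ "insert v Q"]) simp
  qed
qed

text \<open>Weight each subset \<open>T\<close> by \<open>x ^ card T\<close>: as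
  \<open>x \<le> 1\<close>, each counted set weighs at least \<open>x ^ K\<close>, and the total
  weight of all subsets is given by the binomial theorem. The choice of \<open>x\<close> is left to
  the application.\<close>

lemma card_bounded_subsets:
  fixes x :: real
  assumes "finite U" "0 < x" "x \<le> 1"
  shows "real (card {T. T \<subseteq> U \<and> card T \<le> K}) * x ^ K \<le> (1 + x) ^ card U"
proof -
  have "real (card {T. T \<subseteq> U \<and> card T \<le> K}) * x ^ K = (\<Sum>T | T \<subseteq> U \<and> card T \<le> K. x ^ K)"
    by simp
  also have "\<dots> \<le> (\<Sum>T | T \<subseteq> U \<and> card T \<le> K. x ^ card T)"
    using assms by (intro sum_mono power_decreasing) auto
  also have "\<dots> \<le> (\<Sum>T\<in>Pow U. x ^ card T)"
    using assms by (intro sum_mono2) auto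
  also have "\<dots> = (1 + x) ^ card U"
    using prod_add[OF assms(1), of "\<lambda>_. x" "\<lambda>_. 1"] by (simp add: add.commute)
  finally show ?thesis .
qed

section \<open>Degree counting and the two-round container construction\<close>

locale regular_bipartite =
  fixes U :: "'a set" and W :: "'b set" and adj :: "'a \<Rightarrow> 'b \<Rightarrow> bool" and d m :: nat
  assumes finite_U: "finite U" and finite_W: "finite W"
    and card_U: "card U = m" and card_W: "card W = m"
    and degree_U: "\<And>u. u \<in> U \<Longrightarrow> card {v \<in> W. adj u v} = d"
    and degree_W: "\<And>v. v \<in> W \<Longrightarrow> card {u \<in> U. adj u v} = d"
begin

definition edges :: "'a set \<Rightarrow> 'b set \<Rightarrow> ('a \<times> 'b) set" where
  "edges S R = {(u, v). u \<in> S \<and> v \<in> R \<and> adj u v}"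

lemma card_edges_left: "finite S \<Longrightarrow> finite R \<Longrightarrow> card (edges S R) = (\<Sum>u\<in>S. card {v \<in> R. adj u v})"
proof -
  assume "finite S" "finite R"
  moreover have "edges S R = (SIGMA u:S. {v \<in> R. adj u v})"
    by (auto simp: edges_def)
  ultimately show ?thesis
    by simp
qed

lemma card_edges_right:
  assumes "finite S" "finite R"
  shows "card (edges S R) = (\<Sum>v\<in>R. card {u \<in> S. adj u v})"
proof -
  have "prod.swap ` edges S R = (SIGMA v:R. {u \<in> S. adj u v})"
    by (force simp: edges_def)
  then have "card (edges S R) = card (SIGMA v:R. {u \<in> S. adj u v})"
    by (metis card_image inj_swap)
  with assms show ?thesis by simp
qed

lemma finite_edges: "finite S \<Longrightarrow> finite R \<Longrightarrow> finite (edges S R)"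
  by (rule finite_subset[of _ "S \<times> R"]) (auto simp: edges_def)

text \<open>Count the \<open>d * card S\<close> edges leaving \<open>S\<close>. At most
  \<open>d * card (W - R)\<close> end outside \<open>R\<close>; those ending in \<open>R\<close>
  must meet \<open>P\<close> or \<open>Q\<close>, hence number at most
  \<open>(card P + card Q) * k\<close>.\<close>

lemma container_size:
  assumes S: "S \<subseteq> U" and R: "R \<subseteq> W" and PQ: "P \<subseteq> S" "Q \<subseteq> R" "cross_free adj (S - P) (R - Q)"
    and degS: "\<And>u. u \<in> S \<Longrightarrow> card {v \<in> R. adj u v} \<le> k"
    and degR: "\<And>v. v \<in> R \<Longrightarrow> card {u \<in> S. adj u v} \<le> k"
  shows "d * (card S + card R) \<le> d * m + (card P + card Q) * k"
proof -
  have fin: "finite S" "finite R" "finite P" "finite Q"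
    using finite_subset[OF S finite_U] finite_subset[OF R finite_W] PQ(1,2) finite_subset by auto
  have "edges S R \<subseteq> edges P R \<union> edges S Q"
    using PQ by (auto simp: edges_def cross_free_def)
  then have "card (edges S R) \<le> card (edges P R \<union> edges S Q)"
    using fin by (intro card_mono) (auto simp: finite_edges)
  also have "\<dots> \<le> card (edges P R) + card (edges S Q)"
    by (rule card_Un_le)
  also have "card (edges P R) \<le> card P * k"
    unfolding card_edges_left[OF fin(3,2)] using degS PQ sum_bounded_above[of P _ k] by (simp add: subset_iff)
  also have "card (edges S Q) \<le> card Q * k"
    unfolding card_edges_right[OF fin(1,4)] using degR PQ sum_bounded_above[of Q _ k] by (simp add: subset_iff)
  finally have *: "card (edges S R) \<le> (card P + card Q) * k"
    by (simp add: algebra_simps)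
  have "card (edges S (W - R)) \<le> card (edges U (W - R))"
    using S finite_U finite_W by (intro card_mono finite_edges) (auto simp: edges_def)
  also have "\<dots> = d * card (W - R)"
    using finite_U finite_W degree_W by (subst card_edges_right) auto
  finally have "card (edges S (W - R)) \<le> d * card (W - R)" .
  moreover have "d * card S = card (edges S W)"
    using fin finite_W S degree_U by (subst card_edges_left) (auto simp: subset_iff)
  moreover have "edges S W = edges S R \<union> edges S (W - R)"
    using R by (auto simp: edges_def)
  then have "card (edges S W) \<le> card (edges S R) + card (edges S (W - R))"
    using card_Un_le by simp
  ultimately have "d * card S \<le> (card P + card Q) * k + d * card (W - R)"
    using * by linarith
  moreover have "card (W - R) + card R = m"
    using R fin finite_W card_W by (metis card_Diff_subset card_mono le_add_diff_inverse2)
  then have "d * card (W - R) + d * card R = d * m"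
    by (metis distrib_left)
  ultimately show ?thesis
    by (simp add: distrib_left)
qed

text \<open>
  With a maximal matching of \<open>M\<close> edges between the containers, the number of pairs is at most
  \<open>2 powr (card S + card R - 2/5 * M)\<close>. The degree condition bounds \<open>card S + card R\<close> by
  \<open>m + M/5\<close>, and isoperimetry after deletion of the matching by \<open>m - \<delta> + 2 * M\<close>. The weighted
  mean of the two resulting exponents with weights 8:1 no longer involves \<open>M\<close>.
\<close>

lemma count_in_container:
  fixes b \<delta> :: real
  assumes S: "S \<subseteq> U" and R: "R \<subseteq> W" and "0 < d" "10 * k \<le> d"
    and degS: "\<And>u. u \<in> S \<Longrightarrow> card {v \<in> R. adj u v} \<le> k"
    and degR: "\<And>v. v \<in> R \<Longrightarrow> card {u \<in> S. adj u v} \<le> k"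
    and large: "b \<le> card S" "b \<le> card R"
    and iso: "\<And>S R. S \<subseteq> U \<Longrightarrow> R \<subseteq> W \<Longrightarrow> cross_free adj S R \<Longrightarrow> b / 2 \<le> card S \<Longrightarrow> b / 2 \<le> card R
      \<Longrightarrow> card S + card R \<le> m - \<delta>"
    and \<delta>: "\<delta> / 9 \<le> b / 10"
  shows "card {(A, B). A \<subseteq> S \<and> B \<subseteq> R \<and> cross_free adj A B} \<le> 2 powr (m - \<delta> / 9)"
proof -
  have fin: "finite S" "finite R"
    using S R finite_U finite_W by (auto intro: finite_subset)
  obtain M P Q where PQ: "P \<subseteq> S" "Q \<subseteq> R" "card P = M" "card Q = M" "cross_free adj (S - P) (R - Q)"
    and count: "card {(A, B). A \<subseteq> S \<and> B \<subseteq> R \<and> cross_free adj A B} * 4 ^ M \<le> 3 ^ M * 2 ^ (card S + card R)"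
    (is "?c * _ \<le> _")
    using matching_bound[OF fin, of adj] by blast
  have finPQ: "finite P" "finite Q"
    using PQ fin by (auto intro: finite_subset)
  \<comment> \<open>The exponent 2/5 comes from \<open>(3/4) ^ 5 = 243/1024 \<le> 1/4\<close>, so
    each matching edge saves at least 2/5 in the exponent of 2.\<close>
  have "(2 powr (- (2/5))) ^ 5 = (1/4 :: real)"
    by (simp add: powr_power) (simp add: powr_minus)
  then have "(3/4) ^ Suc 4 \<le> (2 powr (- (2/5)) :: real) ^ Suc 4"
    by (simp add: power_divide)
  then have q: "3/4 \<le> 2 powr (- (2/5) :: real)"
    by (rule power_le_imp_le_base) simp
  have "real ?c * 4 ^ M \<le> 3 ^ M * 2 ^ (card S + card R)"
    using of_nat_mono[OF count, where 'a = real] by simp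
  then have "real ?c \<le> (3/4) ^ M * 2 ^ (card S + card R)"
    by (simp add: field_simps power_divide)
  also have "\<dots> \<le> (2 powr (- (2/5))) ^ M * 2 ^ (card S + card R)"
    by (intro mult_right_mono power_mono q) auto
  also have "\<dots> = 2 powr (M * (- (2/5))) * 2 powr (card S + card R)"
    by (simp add: powr_power powr_realpow[of 2 "card S + card R", symmetric])
  also have "\<dots> = 2 powr (card S + card R - 2/5 * M)"
    by (simp add: powr_add[symmetric] algebra_simps)
  finally have le: "real ?c \<le> 2 powr (card S + card R - 2/5 * M)" .
  have "d * (card S + card R) \<le> d * m + (M + M) * k"
    using container_size[OF S R PQ(1,2,5) degS degR] PQ(3,4) by simp
  then have "5 * (d * (card S + card R)) \<le> 5 * (d * m) + M * (10 * k)"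
    by (simp add: algebra_simps)
  also have "\<dots> \<le> 5 * (d * m) + M * d"
    using \<open>10 * k \<le> d\<close> by (intro add_left_mono mult_left_mono) auto
  also have "\<dots> = d * (5 * m + M)"
    by (simp add: algebra_simps)
  finally have "d * (5 * (card S + card R)) \<le> d * (5 * m + M)"
    by (simp add: algebra_simps)
  then have 1: "5 * (card S + card R) \<le> 5 * m + M"
    using \<open>0 < d\<close> by simp
  have "real (card S + card R) - 2/5 * M \<le> m - \<delta> / 9"
  proof (cases "real M \<le> b / 2")
    case True
    \<comment> \<open>Removing at most \<open>b / 2\<close> vertices leaves at least
      \<open>b / 2\<close> on each side, as \<open>iso\<close> requires.\<close>
    have "card (S - P) = card S - M" "card (R - Q) = card R - M" "M \<le> card S" "M \<le> card R"
      using PQ fin finPQ card_Diff_subset card_mono by metis+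
    then have "real (card (S - P)) = real (card S) - M" "real (card (R - Q)) = real (card R) - M"
      by (auto simp: of_nat_diff)
    then have "real (card S) + card R - 2 * M \<le> m - \<delta>"
      using iso[of "S - P" "R - Q"] S R PQ(5) large True by auto
    with 1 show ?thesis by simp
  next
    \<comment> \<open>Here \<open>1\<close> alone gives the exponent \<open>m - M/5\<close>, and
      \<open>M > b / 2\<close> turns \<open>M/5\<close> into more than \<open>b / 10\<close>, which
      dominates \<open>\<delta> / 9\<close>.\<close>
    case False
    with 1 \<delta> show ?thesis by simp
  qed
  with le show ?thesis
    by (meson order_trans powr_mono one_le_numeral)
qed

text \<open>Each pair \<open>(A, B)\<close> is assigned fingerprints \<open>T \<subseteq> A\<close>
  and \<open>T' \<subseteq> B\<close> by two greedy rounds. The containers depend on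
  \<open>(T, T')\<close> only, so the count is at most the number of fingerprint pairs times the
  bound of \<open>count_in_container\<close>.\<close>

lemma count_by_containers:
  fixes b \<delta> :: real
  assumes "0 < k" "10 * k \<le> d"
    and iso: "\<And>S R. S \<subseteq> U \<Longrightarrow> R \<subseteq> W \<Longrightarrow> cross_free adj S R \<Longrightarrow> b / 2 \<le> card S \<Longrightarrow> b / 2 \<le> card R
      \<Longrightarrow> card S + card R \<le> m - \<delta>"
    and \<delta>: "\<delta> / 9 \<le> b / 10"
  shows "card {(A, B). A \<subseteq> U \<and> B \<subseteq> W \<and> cross_free adj A B \<and> b \<le> card A \<and> b \<le> card B}
    \<le> real (card {T. T \<subseteq> U \<and> card T \<le> m div k}) * card {T. T \<subseteq> W \<and> card T \<le> m div k}
      * 2 powr (m - \<delta> / 9)"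
proof -
  let ?F = "{(A, B). A \<subseteq> U \<and> B \<subseteq> W \<and> cross_free adj A B \<and> b \<le> card A \<and> b \<le> card B}"
  let ?X = "{T. T \<subseteq> U \<and> card T \<le> m div k}" and ?Y = "{T. T \<subseteq> W \<and> card T \<le> m div k}"
  define S0 where "S0 T = {u \<in> U. card ({v \<in> W. adj u v} - (\<Union>t\<in>T. {v \<in> W. adj t v})) < k}" for T
  define S where "S T T' = S0 T - (\<Union>t\<in>T'. {u \<in> S0 T. adj u t})" for T T'
  \<comment> \<open>Leaving out the neighbours of \<open>T\<close> keeps the degrees from
    \<open>S T T'\<close> into \<open>R T T'\<close> below \<open>k\<close>, by the definition of
    \<open>S0\<close>; the explicit condition does the same for the opposite direction.\<close>
  define R where "R T T' = {v \<in> W - (\<Union>t\<in>T. {v \<in> W. adj t v}). card {u \<in> S T T'. adj u v} < k}" for T T'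
  define C where "C = (\<lambda>(T, T'). {(A, B). A \<subseteq> S T T' \<and> B \<subseteq> R T T' \<and> cross_free adj A B \<and> b \<le> card A \<and> b \<le> card B})"
  have subS: "S T T' \<subseteq> U" and subR: "R T T' \<subseteq> W" for T T'
    by (auto simp: S_def S0_def R_def)
  have finS: "finite (S T T')" and finR: "finite (R T T')" for T T'
    using finite_subset[OF subS finite_U] finite_subset[OF subR finite_W] by auto
  have cover: "?F \<subseteq> (\<Union>p\<in>?X \<times> ?Y. C p)"
  proof clarify
    fix A B assume AB: "A \<subseteq> U" "B \<subseteq> W" "cross_free adj A B" "b \<le> card A" "b \<le> card B"
    obtain T where T: "T \<subseteq> A" "card T * k \<le> m"
      "\<And>u. u \<in> A \<Longrightarrow> card ({v \<in> W. adj u v} - (\<Union>t\<in>T. {v \<in> W. adj t v})) < k"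
    proof (rule greedy_cover[of A W "\<lambda>u. {v \<in> W. adj u v}" k])
      show "finite A" using AB finite_U finite_subset by blast
    qed (use finite_W card_W \<open>0 < k\<close> in auto)
    have S0: "S0 T \<subseteq> U" "A \<subseteq> S0 T"
      using T(3) AB by (auto simp: S0_def)
    have "card (S0 T) \<le> m"
      using S0 finite_U card_U card_mono by blast
    \<comment> \<open>The second round covers within \<open>S0 T\<close> instead of
      \<open>U\<close>. Since \<open>card (S0 T) \<le> m\<close>, its fingerprint obeys the same
      size bound \<open>m div k\<close>.\<close>
    obtain T' where T': "T' \<subseteq> B" "card T' * k \<le> card (S0 T)"
      "\<And>v. v \<in> B \<Longrightarrow> card ({u \<in> S0 T. adj u v} - (\<Union>t\<in>T'. {u \<in> S0 T. adj u t})) < k"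
    proof (rule greedy_cover[of B "S0 T" "\<lambda>v. {u \<in> S0 T. adj u v}" k])
      show "finite B" "finite (S0 T)" using AB(2) S0(1) finite_U finite_W finite_subset by blast+
    qed (use \<open>0 < k\<close> in auto)
    have "A \<subseteq> S T T'"
      using S0 T'(1) AB(3) by (auto simp: S_def cross_free_def)
    moreover have "{u \<in> S0 T. adj u v} - (\<Union>t\<in>T'. {u \<in> S0 T. adj u t}) = {u \<in> S T T'. adj u v}" for v
      by (auto simp: S_def)
    then have "B \<subseteq> R T T'"
      using T'(3) T(1) AB by (fastforce simp: R_def cross_free_def)
    moreover have "T \<in> ?X" "T' \<in> ?Y"
      using T T' AB \<open>0 < k\<close> \<open>card (S0 T) \<le> m\<close> by (auto simp: less_eq_div_iff_mult_less_eq)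
    ultimately show "(A, B) \<in> (\<Union>p\<in>?X \<times> ?Y. C p)"
      using AB by (auto simp: C_def)
  qed
  have bound: "real (card (C (T, T'))) \<le> 2 powr (m - \<delta> / 9)" for T T'
  \<comment> \<open>Any member of a nonempty class passes the lower bound \<open>b\<close> on to the
    containers; an empty class contributes 0.\<close>
  proof (cases "C (T, T') = {}")
    case False
    then obtain A B where "A \<subseteq> S T T'" "B \<subseteq> R T T'" "b \<le> card A" "b \<le> card B"
      by (auto simp: C_def)
    then have large: "b \<le> card (S T T')" "b \<le> card (R T T')"
      using card_mono[OF finS, of A T T'] card_mono[OF finR, of B T T'] by linarith+
    have "card {v \<in> R T T'. adj u v} \<le> k" if "u \<in> S T T'" for u
    proof -
      have "u \<in> S0 T"
        using that unfolding S_def by blast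
      have "card {v \<in> R T T'. adj u v} \<le> card ({v \<in> W. adj u v} - (\<Union>t\<in>T. {v \<in> W. adj t v}))"
        using finite_W by (intro card_mono) (auto simp: R_def)
      also have "\<dots> < k"
        using \<open>u \<in> S0 T\<close> unfolding S0_def by blast
      finally show ?thesis by simp
    qed
    moreover have "card {u \<in> S T T'. adj u v} \<le> k" if "v \<in> R T T'" for v
      using that unfolding R_def by simp
    ultimately have "card {(A, B). A \<subseteq> S T T' \<and> B \<subseteq> R T T' \<and> cross_free adj A B} \<le> 2 powr (m - \<delta> / 9)"
      using assms(1,2) by (intro count_in_container[OF subS subR _ _ _ _ large iso \<delta>]) auto
    moreover have "card (C (T, T')) \<le> card {(A, B). A \<subseteq> S T T' \<and> B \<subseteq> R T T' \<and> cross_free adj A B}"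
      by (rule card_mono, rule finite_subset[of _ "Pow (S T T') \<times> Pow (R T T')"])
        (auto simp: C_def finS finR)
    ultimately show ?thesis by linarith
  qed auto
  have finXY: "finite (?X \<times> ?Y)"
    using finite_U finite_W by (intro finite_cartesian_product) auto
  have "finite (C (T, T'))" for T T'
    by (rule finite_subset[of _ "Pow (S T T') \<times> Pow (R T T')"]) (auto simp: C_def finS finR)
  then have "finite (C p)" for p
    by (cases p) simp
  then have "card ?F \<le> card (\<Union>p\<in>?X \<times> ?Y. C p)"
    using finXY by (intro card_mono[OF _ cover]) blast
  also have "\<dots> \<le> (\<Sum>p\<in>?X \<times> ?Y. card (C p))"
    by (rule card_UN_le[OF finXY])
  finally have "real (card ?F) \<le> real (\<Sum>p\<in>?X \<times> ?Y. card (C p))"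
    by (rule of_nat_mono)
  also have "\<dots> = (\<Sum>p\<in>?X \<times> ?Y. real (card (C p)))"
    by (rule of_nat_sum)
  also have "\<dots> \<le> real (card (?X \<times> ?Y)) * 2 powr (m - \<delta> / 9)"
    using bound by (intro sum_bounded_above) (metis surj_pair)
  also have "\<dots> = real (card ?X) * card ?Y * 2 powr (m - \<delta> / 9)"
    by (simp add: card_cartesian_product)
  finally show ?thesis .
qed

end

section \<open>Vertex isoperimetry in the cube\<close>

definition flip :: "nat \<Rightarrow> nat set \<Rightarrow> nat set" where
  "flip i x = (if i \<in> x then x - {i} else insert i x)"

definition inner_boundary :: "nat \<Rightarrow> nat set set \<Rightarrow> nat set set" where
  "inner_boundary m A = {x \<in> A. \<exists>i<m. flip i x \<notin> A}"

text \<open>This is the induction step for isoperimetry: \<open>p\<close>, \<open>q\<close> are the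
  densities of the two halves of a set, \<open>x\<close>, \<open>y\<close> those of the boundary in
  these halves. Averaging raises \<open>p * (1 - p)\<close> by the square of
  \<open>(p - q) / 2\<close>. For small \<open>p - q\<close> this is paid for by the step from
  \<open>sqrt s\<close> to \<open>sqrt (s + 1)\<close>, otherwise by
  \<open>p - q \<le> x\<close>.\<close>

lemma two_point:
  fixes p q x y s :: real
  assumes pq: "0 \<le> q" "q \<le> p" "p \<le> 1" and s: "1 \<le> s"
    and x: "p * (1 - p) / sqrt s \<le> x" "p - q \<le> x" and y: "q * (1 - q) / sqrt s \<le> y"
  shows "((p + q) / 2) * (1 - (p + q) / 2) / sqrt (s + 1) \<le> (x + y) / 2"
proof -
  define a where "a = 1 / sqrt s"
  define b where "b = 1 / sqrt (s + 1)"
  define t where "t = (p - q) / 2"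
  define J where "J = p * (1 - p)"
  define J' where "J' = q * (1 - q)"
  have ab: "0 < b" "b \<le> a" "a \<le> 1"
    using s by (auto simp: a_def b_def field_simps)
  \<comment> \<open>The crude constant 7 makes the sum of the two roots at most
    \<open>8 * sqrt s\<close>, whence the 8 in \<open>step\<close>.\<close>
  have "sqrt (s + 1) \<le> 7 * sqrt s"
    using s real_sqrt_le_mono[of "s + 1" "49 * s"] by (simp add: real_sqrt_mult)
  moreover have "(sqrt (s + 1) - sqrt s) * (sqrt (s + 1) + sqrt s) = 1"
    using s by (simp add: algebra_simps)
  moreover have "0 < sqrt s" "sqrt s < sqrt (s + 1)" using s by auto
  ultimately have "1 \<le> (sqrt (s + 1) - sqrt s) * (8 * sqrt s)"
    by (smt (verit) mult_left_mono)
  then have "1 * (b * a\<^sup>2) \<le> ((sqrt (s + 1) - sqrt s) * (8 * sqrt s)) * (b * a\<^sup>2)"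
    using ab by (intro mult_right_mono) auto
  also have "\<dots> = 8 * (a - b)"
  proof -
    have "((z - y) * (8 * y)) * (1 / z * (1 / y)\<^sup>2) = 8 * (1 / y - 1 / z)" if "0 < y" "0 < z" for y z :: real
      using that by (simp add: field_simps power2_eq_square)
    then show ?thesis using s by (simp add: a_def b_def)
  qed
  finally have step: "b * a\<^sup>2 \<le> 8 * (a - b)" by simp
  have "J = 1 / 4 - (p - 1 / 2)\<^sup>2"
    by (simp add: J_def power2_eq_square algebra_simps)
  then have J: "J \<le> 1 / 4" "0 \<le> J" "0 \<le> J'"
    using pq by simp (use pq in \<open>simp_all add: J_def J'_def\<close>)
  have t: "0 \<le> t" "t \<le> 1 / 2" using pq by (auto simp: t_def)
  have mean: "((p + q) / 2) * (1 - (p + q) / 2) = (J + J') / 2 + t\<^sup>2"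
    by (simp add: J_def J'_def t_def field_simps power2_eq_square)
  have x': "a * J \<le> x" "2 * t \<le> x" and y': "a * J' \<le> y"
    using x y by (auto simp: a_def J_def J'_def t_def)
  have J'': "b * J' \<le> a * J'"
    using ab J by (intro mult_right_mono) auto
  text \<open>The larger of the two lower bounds for \<open>x\<close> is decisive; they agree at \<open>t = r\<close>.\<close>
  define r where "r = a * J / 2"
  have r: "0 \<le> r" using ab J by (simp add: r_def)
  have at_r: "b * (J / 2 + r\<^sup>2) \<le> a * J / 2"
  proof -
    have "b * r\<^sup>2 = (b * a\<^sup>2) * J * J / 4"
      by (simp add: r_def power2_eq_square)
    \<comment> \<open>One factor \<open>b * a\<^sup>2\<close> is traded by \<open>step\<close>, and
      one of the two factors \<open>J\<close> by \<open>J \<le> 1 / 4\<close>.\<close>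
    also have "\<dots> \<le> (8 * (a - b)) * J * (1 / 4) / 4"
      using step J ab by (intro divide_right_mono mult_mono[OF mult_right_mono[OF step]]) auto
    also have "\<dots> = (a - b) * J / 2" by simp
    finally show ?thesis by (simp add: algebra_simps)
  qed
  have "b * (J / 2 + t\<^sup>2) \<le> x / 2"
  proof (cases "t \<le> r")
    case True
    then have "b * (J / 2 + t\<^sup>2) \<le> b * (J / 2 + r\<^sup>2)"
      using ab t by (intro mult_left_mono add_left_mono power_mono) auto
    with at_r x' show ?thesis by simp
  next
    case False
    have "r \<le> 1 / 2" using False t by simp
    \<comment> \<open>Beyond \<open>r\<close>, the term \<open>b * t\<^sup>2\<close> grows with
      slope at most 1, no faster than the lower bound \<open>t\<close> for
      \<open>x / 2\<close>.\<close>
    have "b * (t + r) \<le> 1 * 1"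
      using ab t r \<open>r \<le> 1 / 2\<close> by (intro mult_mono) auto
    then have "(b * (t + r)) * (t - r) \<le> 1 * (t - r)"
      using False by (intro mult_right_mono) auto
    then have "b * t\<^sup>2 - b * r\<^sup>2 \<le> t - r"
      by (simp add: algebra_simps power2_eq_square)
    with at_r x' show ?thesis by (simp add: r_def algebra_simps)
  qed
  then have "b * ((J + J') / 2 + t\<^sup>2) \<le> (x + y) / 2"
    using J'' y' by (simp add: algebra_simps add_divide_distrib)
  then show ?thesis
    unfolding mean by (simp add: b_def)
qed

lemma card_split:
  assumes "A \<subseteq> Pow {..<Suc m}"
  shows "card A = card {x \<in> A. m \<notin> x} + card {x \<in> Pow {..<m}. insert m x \<in> A}"
proof -
  let ?B = "{x \<in> Pow {..<m}. insert m x \<in> A}"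
  have "finite A"
    using assms finite_subset by blast
  have 1: "inj_on (insert m) ?B"
    by (rule inj_onI) (metis (no_types, lifting) Diff_insert_absorb Pow_iff lessThan_iff less_irrefl mem_Collect_eq subsetD)
  have 2: "insert m ` ?B = {x \<in> A. m \<in> x}"
  proof (rule Set.set_eqI)
    fix x
    have "x - {m} \<subseteq> {..<m}" if "x \<in> A"
      using that assms by (force simp: lessThan_Suc)
    then show "x \<in> insert m ` ?B \<longleftrightarrow> x \<in> {x \<in> A. m \<in> x}"
      by (auto simp: insert_absorb intro!: image_eqI[of _ _ "x - {m}"])
  qed
  have "card A = card {x \<in> A. m \<notin> x} + card {x \<in> A. m \<in> x}"
    using \<open>finite A\<close> by (subst card_Un_disjoint[symmetric]) (auto intro: arg_cong[where f = card])
  also have "card {x \<in> A. m \<in> x} = card ?B"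
    using card_image[OF 1] unfolding 2 .
  finally show ?thesis .
qed

text \<open>Induction on the dimension, splitting along coordinate \<open>m\<close>. In each layer
  the boundary of \<open>A\<close> contains the boundary of that layer and all its points whose
  partner in the other layer is missing; \<open>two_point\<close> combines the layers.\<close>

lemma vertex_isoperimetry:
  assumes "A \<subseteq> Pow {..<m}"
  shows "(card A / 2 ^ m) * (1 - card A / 2 ^ m) / sqrt (m + 1) \<le> card (inner_boundary m A) / 2 ^ m"
  using assms
proof (induction m arbitrary: A)
  case 0
  then have "A = {} \<or> A = {{}}" by auto
  then show ?case by auto
next
  case (Suc m)
  define A0 where "A0 = {x \<in> A. m \<notin> x}"
  define A1 where "A1 = {x \<in> Pow {..<m}. insert m x \<in> A}"
  define D where "D = inner_boundary (Suc m) A"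
  define D0 where "D0 = {x \<in> D. m \<notin> x}"
  define D1 where "D1 = {x \<in> Pow {..<m}. insert m x \<in> D}"
  have sub: "A0 \<subseteq> Pow {..<m}" "A1 \<subseteq> Pow {..<m}" "D0 \<subseteq> Pow {..<m}" "D1 \<subseteq> Pow {..<m}"
    using Suc.prems by (auto simp: A0_def A1_def D_def D0_def D1_def inner_boundary_def lessThan_Suc)
  have fin: "finite A0" "finite A1" "finite D0" "finite D1"
    using sub by (auto intro: finite_subset)
  have "D \<subseteq> Pow {..<Suc m}"
    using Suc.prems by (auto simp: D_def inner_boundary_def)
  then have cardA: "card A = card A0 + card A1" and cardD: "card D = card D0 + card D1"
    using card_split Suc.prems by (auto simp: A0_def A1_def D0_def D1_def)
  have flip_lt: "m \<notin> flip i x" "flip i (insert m x) = insert m (flip i x)" "flip i x \<subseteq> {..<m}"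
    if "i < m" "x \<subseteq> {..<m}" for i x
    using that by (auto simp: flip_def)
  have flip_m: "flip m x = insert m x" "flip m (insert m x) = x" if "x \<subseteq> {..<m}" for x
    using that by (auto simp: flip_def)
  have D0: "inner_boundary m A0 \<subseteq> D0" "A0 - A1 \<subseteq> D0"
  proof -
    show "inner_boundary m A0 \<subseteq> D0"
    proof
      fix x assume "x \<in> inner_boundary m A0"
      then obtain i where i: "x \<in> A0" "i < m" "flip i x \<notin> A0"
        by (auto simp: inner_boundary_def)
      then have "x \<subseteq> {..<m}" using sub by auto
      with i have "flip i x \<notin> A"
        using flip_lt[of i x] by (auto simp: A0_def)
      with i show "x \<in> D0"
        by (auto simp: A0_def D0_def D_def inner_boundary_def intro!: exI[of _ i])
    qed
    show "A0 - A1 \<subseteq> D0"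
    proof
      fix x assume x: "x \<in> A0 - A1"
      moreover from this have "x \<subseteq> {..<m}" using sub by auto
      ultimately have "flip m x \<notin> A"
        using flip_m[of x] by (auto simp: A1_def)
      with x show "x \<in> D0"
        by (auto simp: A0_def D0_def D_def inner_boundary_def intro!: exI[of _ m])
    qed
  qed
  have D1: "inner_boundary m A1 \<subseteq> D1" "A1 - A0 \<subseteq> D1"
  proof -
    show "inner_boundary m A1 \<subseteq> D1"
    proof
      fix x assume "x \<in> inner_boundary m A1"
      then obtain i where i: "x \<in> A1" "i < m" "flip i x \<notin> A1"
        by (auto simp: inner_boundary_def)
      then have "x \<subseteq> {..<m}" using sub by auto
      with i have "insert m x \<in> A" "flip i (insert m x) \<notin> A"
        using flip_lt[of i x] by (auto simp: A1_def)
      with \<open>i < m\<close> \<open>x \<subseteq> {..<m}\<close> show "x \<in> D1"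
        by (auto simp: D1_def D_def inner_boundary_def intro!: exI[of _ i])
    qed
    show "A1 - A0 \<subseteq> D1"
    proof
      fix x assume "x \<in> A1 - A0"
      moreover from this have x: "x \<subseteq> {..<m}" using sub by auto
      ultimately have "insert m x \<in> A" "flip m (insert m x) \<notin> A"
        using flip_m[of x] by (auto simp: A1_def A0_def)
      with x show "x \<in> D1"
        by (auto simp: D1_def D_def inner_boundary_def intro!: exI[of _ m])
    qed
  qed
  define M where "M = (2::real) ^ m"
  have "0 < M" by (simp add: M_def)
  have le: "card A0 \<le> M" "card A1 \<le> M"
    using of_nat_mono[OF card_mono[OF _ sub(1)], where 'a = real] of_nat_mono[OF card_mono[OF _ sub(2)], where 'a = real]
    by (simp_all add: card_Pow M_def)
  have diff: "real (card B) - card C \<le> card D'" if "B - C \<subseteq> D'" "finite B" "finite C" "finite D'" for B C D' :: "nat set set"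
    using card_mono[OF that(4,1)] diff_card_le_card_Diff[OF that(3), of B] by linarith
  have bd: "card (inner_boundary m A0) / M \<le> card D0 / M" "card (inner_boundary m A1) / M \<le> card D1 / M"
    "card A0 / M - card A1 / M \<le> card D0 / M" "card A1 / M - card A0 / M \<le> card D1 / M"
    using D0 D1 fin \<open>0 < M\<close> diff[of A0 A1 D0] diff[of A1 A0 D1]
    by (auto intro!: divide_right_mono card_mono simp flip: diff_divide_distrib)
  note IH = order_trans[OF Suc.IH[OF sub(1), folded M_def] bd(1)] order_trans[OF Suc.IH[OF sub(2), folded M_def] bd(2)]
  define p where "p = card A0 / M"
  define q where "q = card A1 / M"
  have pq: "0 \<le> p" "p \<le> 1" "0 \<le> q" "q \<le> 1"
    using le \<open>0 < M\<close> by (auto simp: p_def q_def)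
  have "((p + q) / 2) * (1 - (p + q) / 2) / sqrt (real (m + 1) + 1) \<le> (card D0 / M + card D1 / M) / 2"
  \<comment> \<open>\<open>two_point\<close> expects the denser layer first, so the layers are
    swapped if necessary.\<close>
  proof (cases "q \<le> p")
    case True
    show ?thesis
      by (rule two_point) (use True pq IH bd in \<open>auto simp: p_def q_def add.commute\<close>)
  next
    case False
    have "((q + p) / 2) * (1 - (q + p) / 2) / sqrt (real (m + 1) + 1) \<le> (card D1 / M + card D0 / M) / 2"
      by (rule two_point) (use False pq IH bd in \<open>auto simp: p_def q_def add.commute\<close>)
    then show ?thesis by (simp add: add.commute)
  qed
  moreover have "(p + q) / 2 = card A / 2 ^ Suc m" "(card D0 / M + card D1 / M) / 2 = card D / 2 ^ Suc m"
    by (simp_all add: p_def q_def M_def cardA cardD add_divide_distrib)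
  ultimately show ?case
    by (simp add: D_def)
qed

section \<open>The hypercube graph\<close>

definition diff_set :: "nat \<Rightarrow> bit vec \<Rightarrow> bit vec \<Rightarrow> nat set" where
  "diff_set n u v = {i. i < n \<and> u $ i \<noteq> v $ i}"

lemma finite_diff_set [simp]: "finite (diff_set n u v)"
  by (simp add: diff_set_def)

lemma diff_set_commute: "diff_set n u v = diff_set n v u"
  by (auto simp: diff_set_def)

lemma diff_set_empty:
  assumes "u \<in> carrier_vec n" "v \<in> carrier_vec n" "diff_set n u v = {}"
  shows "u = v"
  using assms by (intro eq_vecI) (auto simp: diff_set_def)

lemma hypercube_arc:
  "(u, v) \<in> parcs (hypercube n) \<longleftrightarrow> u \<in> carrier_vec n \<and> v \<in> carrier_vec n \<and> card (diff_set n u v) = 1"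
  by (simp add: hypercube_def diff_set_def)

text \<open>The difference set is the symmetric difference of the supports, whose size has the
  parity of the sum of the weights.\<close>

lemma even_card_diff_set:
  assumes "u \<in> carrier_vec n" "v \<in> carrier_vec n"
  shows "even (card (diff_set n u v)) \<longleftrightarrow> (even (hamming_weight u) \<longleftrightarrow> even (hamming_weight v))"
proof -
  define X where "X = {i. i < n \<and> u $ i \<noteq> 0}"
  define Y where "Y = {i. i < n \<and> v $ i \<noteq> 0}"
  have fin: "finite X" "finite Y" by (auto simp: X_def Y_def)
  have w: "hamming_weight u = card X" "hamming_weight v = card Y"
    using assms by (auto simp: hamming_weight_def X_def Y_def)
  have "diff_set n u v = (X - Y) \<union> (Y - X)"
    by (auto simp: diff_set_def X_def Y_def bit_not_zero_iff)
  moreover have "(X - Y) \<inter> (Y - X) = {}"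
    by blast
  ultimately have "card (diff_set n u v) = card (X - Y) + card (Y - X)"
    using fin by (metis card_Un_disjoint finite_Diff)
  moreover have "card X = card (X \<inter> Y) + card (X - Y)" "card Y = card (X \<inter> Y) + card (Y - X)"
    using fin by (metis card_Int_Diff Int_commute)+
  ultimately show ?thesis by (simp add: w) blast
qed

lemma arc_parity:
  "(u, v) \<in> parcs (hypercube n) \<Longrightarrow> even (hamming_weight u) \<longleftrightarrow> odd (hamming_weight v)"
  using even_card_diff_set[of u n v] by (auto simp: hypercube_arc)

lemma card_hypercube_neighbours:
  assumes u: "u \<in> carrier_vec n"
  shows "card {v \<in> carrier_vec n. card (diff_set n u v) = 1} = n"
proof -
  define g where "g i = vec n (\<lambda>j. if j = i then if u $ j = 0 then 1 else 0 else u $ j)" for i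
  have "u $ j \<noteq> g i $ j \<longleftrightarrow> j = i" if "j < n" for i j
    using that by (cases "u $ j = 0") (auto simp: g_def)
  then have D: "diff_set n u (g i) = {i}" if "i < n" for i
    using that by (auto simp: diff_set_def)
  have "bij_betw g {..<n} {v \<in> carrier_vec n. card (diff_set n u v) = 1}"
  proof (rule bij_betw_imageI)
    show "inj_on g {..<n}"
      by (rule inj_onI) (metis D lessThan_iff singleton_inject)
    show "g ` {..<n} = {v \<in> carrier_vec n. card (diff_set n u v) = 1}"
    proof (intro equalityI subsetI)
      fix v assume "v \<in> {v \<in> carrier_vec n. card (diff_set n u v) = 1}"
      then have v: "v \<in> carrier_vec n" and "card (diff_set n u v) = 1" by auto
      then obtain i where i: "diff_set n u v = {i}"
        by (auto simp: card_1_singleton_iff)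
      then have "i < n" "u $ i \<noteq> v $ i"
        by (auto simp: diff_set_def)
      then have "v $ i = (if u $ i = 0 then 1 else 0)"
        by (metis bit_not_zero_iff)
      moreover have "v $ j = u $ j" if "j < n" "j \<noteq> i" for j
      proof -
        have "j \<notin> diff_set n u v"
          using i that by simp
        with that show ?thesis
          unfolding diff_set_def by (metis (mono_tags) mem_Collect_eq)
      qed
      ultimately have "v = g i"
        using v \<open>i < n\<close> by (intro eq_vecI) (simp_all add: g_def)
      with \<open>i < n\<close> show "v \<in> g ` {..<n}" by auto
    next
      fix v assume "v \<in> g ` {..<n}"
      then show "v \<in> {v \<in> carrier_vec n. card (diff_set n u v) = 1}"
        using D by (auto simp: g_def)
    qed
  qed
  then show ?thesis
    using bij_betw_same_card by fastforce
qed

text \<open>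
  Dropping the last coordinate identifies either parity class of the \<open>(m+1)\<close>-dimensional cube
  with the \<open>m\<close>-dimensional cube, and a vector is adjacent exactly to the closed neighbourhood of
  its image.
\<close>

definition drop_last :: "nat \<Rightarrow> bit vec \<Rightarrow> nat set" where
  "drop_last m v = {i. i < m \<and> v $ i \<noteq> 0}"

lemma diff_set_drop_last:
  assumes "sym_diff (drop_last m u) (drop_last m v) \<subseteq> X"
  shows "diff_set (Suc m) u v \<subseteq> insert m X"
proof
  fix i assume "i \<in> diff_set (Suc m) u v"
  then have "i = m \<or> i \<in> sym_diff (drop_last m u) (drop_last m v)"
    by (auto simp: diff_set_def drop_last_def less_Suc_eq bit_not_zero_iff)
  with assms show "i \<in> insert m X" by blast
qed

text \<open>Vectors with equal image differ at most in coordinate \<open>m\<close>, and equal parity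
  rules out exactly one difference.\<close>

lemma inj_on_drop_last:
  assumes "\<And>u v. u \<in> V \<Longrightarrow> v \<in> V \<Longrightarrow> even (hamming_weight u) \<longleftrightarrow> even (hamming_weight v)"
    and "V \<subseteq> carrier_vec (Suc m)"
  shows "inj_on (drop_last m) V"
proof (rule inj_onI)
  fix u v assume uv: "u \<in> V" "v \<in> V" "drop_last m u = drop_last m v"
  have "diff_set (Suc m) u v \<subseteq> {m}"
    using uv(3) by (intro diff_set_drop_last) auto
  moreover have "even (card (diff_set (Suc m) u v))"
    using uv assms even_card_diff_set[of u "Suc m" v] by blast
  ultimately have "diff_set (Suc m) u v = {}"
    by (metis card.empty card.insert empty_iff finite.emptyI odd_one One_nat_def subset_singleton_iff)
  with uv assms(2) show "u = v"
    by (intro diff_set_empty[of u "Suc m"]) auto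
qed

lemma inj_on_drop_last_parity:
  "inj_on (drop_last m) (even_vectors (Suc m))" "inj_on (drop_last m) (odd_vectors (Suc m))"
  by (rule inj_on_drop_last; auto simp: even_vectors_def odd_vectors_def)+

text \<open>The vectors differ in at most the two coordinates \<open>m\<close> and \<open>i\<close>,
  and by parity in an odd number of them. The inclusion in \<open>{i}\<close> covers images that are
  equal or adjacent.\<close>

lemma arc_if_drop_last_close:
  assumes "u \<in> even_vectors (Suc m)" "v \<in> odd_vectors (Suc m)"
    and "sym_diff (drop_last m u) (drop_last m v) \<subseteq> {i}"
  shows "(u, v) \<in> parcs (hypercube (Suc m))"
proof -
  have "card (diff_set (Suc m) u v) \<le> card {m, i}"
    using diff_set_drop_last[OF assms(3)] by (intro card_mono) auto
  also have "\<dots> \<le> 2"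
    by (simp add: card_insert_if)
  finally have "card (diff_set (Suc m) u v) \<le> 2" .
  moreover have "odd (card (diff_set (Suc m) u v))"
    using assms even_card_diff_set[of u "Suc m" v] by (auto simp: even_vectors_def odd_vectors_def)
  ultimately have "card (diff_set (Suc m) u v) = 1"
    by (metis One_nat_def even_numeral le_Suc_eq le_zero_eq even_zero numeral_2_eq_2)
  with assms show ?thesis
    by (auto simp: hypercube_arc even_vectors_def odd_vectors_def)
qed

lemma even_odd_vectors:
  "even_vectors n \<union> odd_vectors n = carrier_vec n" "even_vectors n \<inter> odd_vectors n = {}"
  by (auto simp: even_vectors_def odd_vectors_def)

lemma finite_even_odd: "finite (even_vectors n)" "finite (odd_vectors n)"
  using finite_subset[OF _ finite_carrier_vec_bit[of n]] even_odd_vectors(1)[of n] by blast+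

text \<open>Injectivity of \<open>drop_last\<close> bounds either class by \<open>2 ^ m\<close>;
  their sum \<open>2 ^ Suc m\<close> forces equality.\<close>

lemma card_even_odd: "card (even_vectors (Suc m)) = 2 ^ m" "card (odd_vectors (Suc m)) = 2 ^ m"
proof -
  have "card V \<le> 2 ^ m" if "inj_on (drop_last m) V" for V
  proof -
    have "card V = card (drop_last m ` V)"
      using that by (simp add: card_image)
    also have "\<dots> \<le> card (Pow {..<m})"
      by (rule card_mono) (auto simp: drop_last_def)
    finally show ?thesis by (simp add: card_Pow)
  qed
  then have "card (even_vectors (Suc m)) \<le> 2 ^ m" "card (odd_vectors (Suc m)) \<le> 2 ^ m"
    using inj_on_drop_last_parity by auto
  moreover have "card (even_vectors (Suc m)) + card (odd_vectors (Suc m)) = 2 ^ Suc m"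
    using card_Un_disjoint[OF finite_even_odd even_odd_vectors(2), of "Suc m"]
    by (simp add: even_odd_vectors card_carrier_vec_bit)
  ultimately show "card (even_vectors (Suc m)) = 2 ^ m" "card (odd_vectors (Suc m)) = 2 ^ m"
    by auto
qed

abbreviation cube_adj :: "nat \<Rightarrow> bit vec \<Rightarrow> bit vec \<Rightarrow> bool" where
  "cube_adj n u v \<equiv> (u, v) \<in> parcs (hypercube n)"

text \<open>All neighbours of a vector have the opposite parity, so the full degree goes to the
  other class. The class size, called \<open>m\<close> in the locale, is \<open>2 ^ m\<close>
  here.\<close>

lemma regular_bipartite_hypercube:
  "regular_bipartite (even_vectors (Suc m)) (odd_vectors (Suc m)) (cube_adj (Suc m)) (Suc m) (2 ^ m)"
proof
  fix u assume u: "u \<in> even_vectors (Suc m)"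
  then have "{v \<in> odd_vectors (Suc m). cube_adj (Suc m) u v}
      = {v \<in> carrier_vec (Suc m). card (diff_set (Suc m) u v) = 1}"
    using arc_parity[of u] by (auto simp: even_vectors_def odd_vectors_def hypercube_arc)
  then show "card {v \<in> odd_vectors (Suc m). cube_adj (Suc m) u v} = Suc m"
    using card_hypercube_neighbours u by (auto simp: even_vectors_def)
next
  fix v assume v: "v \<in> odd_vectors (Suc m)"
  then have "{u \<in> even_vectors (Suc m). cube_adj (Suc m) u v}
      = {u \<in> carrier_vec (Suc m). card (diff_set (Suc m) v u) = 1}"
    using arc_parity[of _ v] diff_set_commute[of "Suc m" v]
    by (auto simp: even_vectors_def odd_vectors_def hypercube_arc)
  then show "card {u \<in> even_vectors (Suc m). cube_adj (Suc m) u v} = Suc m"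
    using card_hypercube_neighbours v by (auto simp: odd_vectors_def)
qed (simp_all add: finite_even_odd card_even_odd)

text \<open>Let \<open>A\<close> be the complement of the image of \<open>S\<close>. Since no edge
  joins \<open>S\<close> and \<open>R\<close>, the image of \<open>R\<close> lies in
  \<open>A\<close> together with all its neighbours, hence avoids the inner boundary of
  \<open>A\<close>. The size of that boundary is the deficit.\<close>

lemma cross_free_isoperimetry:
  fixes c :: real
  assumes S: "S \<subseteq> even_vectors (Suc m)" and R: "R \<subseteq> odd_vectors (Suc m)"
    and free: "cross_free (cube_adj (Suc m)) S R" and c: "0 \<le> c" "c \<le> card S" "c \<le> card R"
  shows "card S + card R \<le> 2 ^ m - c\<^sup>2 / (2 ^ m * sqrt (Suc m))"
proof -
  define A where "A = Pow {..<m} - drop_last m ` S"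
  have sub: "A \<subseteq> Pow {..<m}" by (auto simp: A_def)
  have finA: "finite A" using finite_subset[OF sub] by simp
  have cS: "card (drop_last m ` S) = card S" and cR: "card (drop_last m ` R) = card R"
    using inj_on_subset[OF inj_on_drop_last_parity(1) S] inj_on_subset[OF inj_on_drop_last_parity(2) R]
    by (auto simp: card_image)
  have pow: "drop_last m ` S \<subseteq> Pow {..<m}" "drop_last m ` R \<subseteq> Pow {..<m}"
    by (auto simp: drop_last_def)
  have "card A = 2 ^ m - card S" "card S \<le> 2 ^ m"
    using card_Diff_subset[OF finite_subset[OF pow(1)] pow(1)] card_mono[OF _ pow(1)] cS
    by (auto simp: A_def card_Pow)
  then have cA: "real (card A) = (2::real) ^ m - real (card S)"
    by (simp add: of_nat_diff)
  have bd: "drop_last m ` R \<subseteq> A - inner_boundary m A"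
  proof clarify
    fix v assume v: "v \<in> R"
    have far: "x \<notin> drop_last m ` S" if "sym_diff x (drop_last m v) \<subseteq> {i}" for x i
      using arc_if_drop_last_close[of _ m v i] that S R v free by (force simp: cross_free_def)
    have "drop_last m v \<notin> drop_last m ` S"
      by (rule far) auto
    moreover have "flip i (drop_last m v) \<notin> drop_last m ` S" for i
      by (rule far[of _ i]) (auto simp: flip_def)
    moreover have "flip i (drop_last m v) \<subseteq> {..<m}" if "i < m" for i
      using that by (auto simp: flip_def drop_last_def)
    ultimately show "drop_last m v \<in> A - inner_boundary m A"
      using pow v by (auto simp: A_def inner_boundary_def)
  qed
  have inner: "inner_boundary m A \<subseteq> A" by (auto simp: inner_boundary_def)
  have "card R \<le> card (A - inner_boundary m A)"
    using card_mono[OF _ bd] finA by (simp add: cR)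
  also have "\<dots> = card A - card (inner_boundary m A)"
    using inner finA by (intro card_Diff_subset) (auto intro: finite_subset)
  finally have R_le: "real (card R) + card (inner_boundary m A) \<le> card A"
    using card_mono[OF finA inner] by linarith
  \<comment> \<open>\<open>A\<close> is at least as large as \<open>R\<close> and its complement as
    large as \<open>S\<close>, so both densities in the isoperimetric bound are at least
    \<open>c / 2 ^ m\<close>.\<close>
  have le: "c / 2 ^ m \<le> card A / 2 ^ m" "c / 2 ^ m \<le> 1 - card A / 2 ^ m"
    using c R_le unfolding cA by (simp_all add: field_simps)
  have "(c / 2 ^ m) * (c / 2 ^ m) / sqrt (Suc m) \<le> (card A / 2 ^ m) * (1 - card A / 2 ^ m) / sqrt (Suc m)"
    using c(1) by (intro divide_right_mono mult_mono[OF le]) auto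
  also have "\<dots> \<le> card (inner_boundary m A) / 2 ^ m"
    using vertex_isoperimetry[OF sub] by (simp add: add.commute)
  finally have "c\<^sup>2 / (2 ^ m * sqrt (Suc m)) \<le> card (inner_boundary m A)"
    by (simp add: field_simps power2_eq_square)
  with R_le cA show ?thesis
    unfolding of_nat_add by linarith
qed

section \<open>Parameters and the final estimate\<close>

text \<open>This is the cost of one fingerprint when \<open>k = n div 10\<close>:
  \<open>card_bounded_subsets\<close> with \<open>x = 1 / n\<close> bounds the count by
  \<open>n ^ K * exp (M / n)\<close>.\<close>

lemma card_bounded_subsets_powr:
  assumes "finite V" "card V = M" "20 \<le> n"
  shows "real (card {T. T \<subseteq> V \<and> card T \<le> M div (n div 10)}) \<le> 2 powr (M * ((20 * ln n + 1) / (n * ln 2)))"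
proof -
  define K where "K = M div (n div 10)"
  have "real (card {T. T \<subseteq> V \<and> card T \<le> K}) * (1 / n) ^ K \<le> (1 + 1 / n) ^ M"
    using card_bounded_subsets[OF assms(1), of "1 / n" K] assms(3) unfolding assms(2) by simp
  also have "\<dots> \<le> exp (1 / n) ^ M"
    by (intro power_mono exp_ge_add_one_self) auto
  finally have "real (card {T. T \<subseteq> V \<and> card T \<le> K}) \<le> real n ^ K * exp (1 / n) ^ M"
    using assms(3) by (simp add: field_simps)
  also have "\<dots> = exp (K * ln n + M / n)"
    using assms(3) by (simp add: exp_add exp_of_nat_mult[symmetric] exp_of_nat_mult)
  also have "\<dots> \<le> exp (M * (20 * ln n + 1) / n)"
  proof -
    \<comment> \<open>For \<open>n \<ge> 20\<close> rounding down at most halves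
      \<open>n / 10\<close>, which gives \<open>K \<le> 20 * M / n\<close> and the constant 20 in
      the statement.\<close>
    have "n \<le> 20 * (n div 10)" "0 < n div 10"
      using assms(3) by linarith+
    then have "K * n \<le> 20 * (K * (n div 10))"
      by (metis mult.left_commute mult_le_mono2)
    also have "\<dots> \<le> 20 * M"
      by (simp add: K_def div_times_less_eq_dividend)
    finally have "real (K * n) \<le> real (20 * M)"
      by (rule of_nat_mono)
    then have "real K \<le> 20 * M / n"
      using assms(3) by (simp add: field_simps)
    then have "K * ln n \<le> 20 * M / n * ln n"
      using assms(3) by (intro mult_right_mono) auto
    then show ?thesis
      by (simp add: field_simps add_divide_distrib)
  qed
  also have "\<dots> = 2 powr (M * ((20 * ln n + 1) / (n * ln 2)))"
    by (simp add: powr_def)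
  finally show ?thesis by (simp add: K_def)
qed

text \<open>The bound \<open>9/5 * sqrt n\<close> on \<open>\<beta>\<close> amounts to
  \<open>\<delta> / 9 \<le> b / 10\<close>. After division by \<open>2 ^ (n - 1)\<close>,
  \<open>small\<close> says that \<open>\<delta> / 9\<close> pays for both fingerprints and still
  leaves the saving claimed.\<close>

lemma count_balanced:
  fixes \<beta> :: real
  assumes \<beta>: "0 < \<beta>" "\<beta> \<le> 9/5 * sqrt n" and n: "20 \<le> n"
    and small: "2 * ((20 * ln n + 1) / (n * ln 2)) + 1 / n \<le> \<beta>\<^sup>2 / (9 * sqrt n)"
  shows "real (card {I. independent_set (hypercube n) I \<and>
      real (min (card (I \<inter> even_vectors n)) (card (I \<inter> odd_vectors n))) > \<beta> * 2 ^ n})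
    \<le> 2 powr (2 ^ n / 2 - 2 ^ n / 2 / n)"
proof -
  obtain m where m: "n = Suc m" using n by (cases n) auto
  interpret regular_bipartite "even_vectors n" "odd_vectors n" "cube_adj n" n "2 ^ m"
    unfolding m by (rule regular_bipartite_hypercube)
  define b where "b = \<beta> * 2 ^ n"
  \<comment> \<open>This is the deficit of \<open>cross_free_isoperimetry\<close> at
    \<open>c = b / 2\<close>, the size guaranteed after deletion of a small matching.\<close>
  define \<delta> where "\<delta> = (b / 2)\<^sup>2 / (2 ^ m * sqrt n)"
  have \<delta>_eq: "\<delta> = 2 ^ m * (\<beta>\<^sup>2 / sqrt n)"
    using n by (simp add: \<delta>_def b_def m field_simps power2_eq_square)
  have "\<beta> * \<beta> \<le> \<beta> * (9/5 * sqrt n)"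
    using \<beta> by (intro mult_left_mono) auto
  then have "\<beta>\<^sup>2 / sqrt n \<le> 9/5 * \<beta>"
    using n by (simp add: field_simps power2_eq_square)
  then have "\<delta> \<le> 2 ^ m * (9/5 * \<beta>)"
    unfolding \<delta>_eq by (intro mult_left_mono) auto
  then have \<delta>_le: "\<delta> / 9 \<le> b / 10"
    by (simp add: b_def m mult_ac)
  let ?L = "{I. independent_set (hypercube n) I \<and>
      real (min (card (I \<inter> even_vectors n)) (card (I \<inter> odd_vectors n))) > \<beta> * 2 ^ n}"
  let ?P = "{(A, B). A \<subseteq> even_vectors n \<and> B \<subseteq> odd_vectors n \<and> cross_free (cube_adj n) A B \<and> b \<le> card A \<and> b \<le> card B}"
  let ?g = "\<lambda>I. (I \<inter> even_vectors n, I \<inter> odd_vectors n)"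
  let ?e = "2 ^ m * ((20 * ln n + 1) / (n * ln 2)) :: real"
  have "inj_on ?g ?L"
  proof (rule inj_onI)
    fix I J assume "I \<in> ?L" "J \<in> ?L" and eq: "?g I = ?g J"
    then have "I \<subseteq> even_vectors n \<union> odd_vectors n" "J \<subseteq> even_vectors n \<union> odd_vectors n"
      unfolding even_odd_vectors by (auto simp: independent_set_def hypercube_def)
    with eq show "I = J" by blast
  qed
  moreover have "?g ` ?L \<subseteq> ?P"
    by (auto simp: independent_set_def cross_free_def b_def)
  moreover have "finite ?P"
    by (rule finite_subset[of _ "Pow (even_vectors n) \<times> Pow (odd_vectors n)"])
      (auto simp: finite_U finite_W)
  ultimately have "card ?L \<le> card ?P"
    by (rule card_inj_on_le)
  then have "real (card ?L) \<le> card ?P" by simp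
  also have "\<dots> \<le> real (card {T. T \<subseteq> even_vectors n \<and> card T \<le> 2 ^ m div (n div 10)})
      * card {T. T \<subseteq> odd_vectors n \<and> card T \<le> 2 ^ m div (n div 10)} * 2 powr (real (2 ^ m) - \<delta> / 9)"
  proof (rule count_by_containers[OF _ _ _ \<delta>_le])
    show "0 < n div 10" "10 * (n div 10) \<le> n"
      using n by linarith+
    show "real (card S + card R) \<le> real (2 ^ m) - \<delta>"
      if "S \<subseteq> even_vectors n" "R \<subseteq> odd_vectors n" "cross_free (cube_adj n) S R"
        "b / 2 \<le> card S" "b / 2 \<le> card R" for S R
      using cross_free_isoperimetry[of S m R "b / 2"] that \<beta>(1) by (simp add: m \<delta>_def b_def)
  qed
  also have "\<dots> \<le> 2 powr ?e * 2 powr ?e * 2 powr (real (2 ^ m) - \<delta> / 9)"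
    using card_bounded_subsets_powr[OF finite_U card_U n] card_bounded_subsets_powr[OF finite_W card_W n]
    by (intro mult_right_mono mult_mono) auto
  also have "\<dots> = 2 powr (2 * ?e + 2 ^ m - \<delta> / 9)"
    by (simp add: powr_add[symmetric] algebra_simps)
  also have "\<dots> \<le> 2 powr (2 ^ n / 2 - 2 ^ n / 2 / n)"
  proof -
    have "2 ^ m * (2 * ((20 * ln n + 1) / (n * ln 2)) + 1 / n) \<le> 2 ^ m * (\<beta>\<^sup>2 / (9 * sqrt n))"
      using small by (intro mult_left_mono) auto
    then have "2 * ?e + 2 ^ m / n \<le> \<delta> / 9"
      by (simp add: \<delta>_eq distrib_left mult_ac)
    then show ?thesis
      by (intro powr_mono) (auto simp: m)
  qed
  finally show ?thesis .
qed

theorem theorem5p7: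
  shows "\<forall>\<beta>::real. \<beta> > 0 \<longrightarrow> (\<exists>C::real. C > 0 \<and> (\<forall>\<^sub>F n::nat in sequentially.
    let N = (2::real) ^ n in
      real (card {I. independent_set (hypercube n) I \<and>
        real (min (card (I \<inter> even_vectors n)) (card (I \<inter> odd_vectors n))) > \<beta> * N})
      \<le> 2 powr (N / 2 - sqrt N / 2 powr (C * sqrt (real n)))))"
\<comment> \<open>\<open>C = 1\<close> serves for every \<open>\<beta>\<close>: the saving
  \<open>N / (2 * n)\<close> from \<open>count_balanced\<close> eventually exceeds
  \<open>sqrt N\<close>, and dividing \<open>sqrt N\<close> by \<open>2 powr sqrt n \<ge> 1\<close>
  only lowers the target.\<close>
proof (intro allI impI exI[of _ 1] conjI)
  fix \<beta> :: real assume \<beta>: "0 < \<beta>"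
  have "filterlim (\<lambda>n::nat. 9/5 * sqrt n) at_top sequentially"
    by real_asymp
  then have "\<forall>\<^sub>F n::nat in sequentially. \<beta> \<le> 9/5 * sqrt n"
    by (simp add: filterlim_at_top)
  moreover have "\<forall>\<^sub>F n::nat in sequentially. 2 * ((20 * ln n + 1) / (n * ln 2)) + 1 / n \<le> \<beta>\<^sup>2 / (9 * sqrt n)"
  proof -
    \<comment> \<open>Fingerprints cost order \<open>ln n / n\<close> per vertex and the gain is of
      order \<open>1 / sqrt n\<close>; the ratio tends to 0.\<close>
    have "((\<lambda>n::nat. (2 * ((20 * ln n + 1) / (n * ln 2)) + 1 / n) * (9 * sqrt n)) \<longlongrightarrow> 0) sequentially"
      by real_asymp
    then have "\<forall>\<^sub>F n::nat in sequentially. (2 * ((20 * ln n + 1) / (n * ln 2)) + 1 / n) * (9 * sqrt n) < \<beta>\<^sup>2"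
      using \<beta> by (intro order_tendstoD(2)) auto
    then show ?thesis
      using eventually_gt_at_top[of "0::nat"]
    proof eventually_elim
      case (elim n)
      have "0 < 9 * sqrt n" using elim(2) by simp
      show ?case
        unfolding pos_le_divide_eq[OF \<open>0 < 9 * sqrt n\<close>] using elim(1) by (rule less_imp_le)
    qed
  qed
  moreover have "\<forall>\<^sub>F n::nat in sequentially. sqrt (2 ^ n) \<le> 2 ^ n / 2 / n"
    by real_asymp
  ultimately show "\<forall>\<^sub>F n::nat in sequentially. let N = (2::real) ^ n in
      real (card {I. independent_set (hypercube n) I \<and>
        real (min (card (I \<inter> even_vectors n)) (card (I \<inter> odd_vectors n))) > \<beta> * N})
      \<le> 2 powr (N / 2 - sqrt N / 2 powr (1 * sqrt (real n)))"
    using eventually_ge_at_top[of "20::nat"]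
  proof eventually_elim
    case (elim n)
    have "sqrt (2 ^ n) / 2 powr (1 * sqrt n) \<le> sqrt (2 ^ n) / 1"
      by (intro divide_left_mono ge_one_powr_ge_zero) auto
    also have "\<dots> \<le> 2 ^ n / 2 / n"
      using elim(3) unfolding div_by_1 .
    finally have "2 powr (2 ^ n / 2 - 2 ^ n / 2 / n) \<le> 2 powr (2 ^ n / 2 - sqrt (2 ^ n) / 2 powr (1 * sqrt n))"
      by (intro powr_mono) auto
    with count_balanced[OF \<beta> elim(1,4,2)] show ?case
      unfolding Let_def by linarith
  qed
qed simp

end
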